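(* Let $\{\alpha_0,\alpha_1,\dots,\alpha_{k-1}\}\subset\mathbb{F}_{2^m}$ be a set of $k$ elements linearly independent over $\mathbb{F}_2$. For $i=0,\dots,k-1$ let $f_i(x,y)=\mathrm{Tr}^m_1(x\pi_i(y))$ for $x,y\in\mathbb{F}_{2^m}$, where $\pi_i(y)=\alpha_iy^{-1}$ for $y\in\mathbb{F}_{2^m}^*$ and $\pi_i(0)=0$. Then the function $F:\mathbb{F}_{2^m}\times\mathbb{F}_{2^m}\to\mathbb{Z}_{2^k}$, $F(x,y)=f_0(x,y)+2f_1(x,y)+\cdots+2^{k-1}f_{k-1}(x,y)$, is $\mathbb{Z}_{2^k}$-bent.
   Context: $\mathrm{Tr}^m_1$ is the absolute trace $\mathbb{F}_{2^m}\to\mathbb{F}_2$; the values $f_i\in\{0,1\}$ are regarded as integers. A function $F:\mathbb{F}_{2^m}\times\mathbb{F}_{2^m}\to\mathbb{Z}_{2^k}$ is $\mathbb{Z}_{2^k}$-bent if $\bigl|\sum_{x,y\in\mathbb{F}_{2^m}}\zeta_{2^k}^{cF(x,y)}(-1)^{\mathrm{Tr}^m_1(u_1x+u_2y)}\bigr|=2^m$ for all $(u_1,u_2)\in\mathbb{F}_{2^m}^2$ and all nonzero $c\in\mathbb{Z}_{2^k}$, where $\zeta_{2^k}=e^{2\pi\sqrt{-1}/2^k}$. *)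

theory Defs
  imports Complex_Main "HOL-Library.Z2" "HOL-Library.Cardinality"
    "HOL-Computational_Algebra.Primes"
begin

text \<open>
  The field with \<open>2\<^sup>m\<close> elements is any type \<open>'a\<close> of class
  \<^class>\<open>finite_field\<close> with \<open>CARD('a) = 2 ^ m\<close>; its prime field is the type \<^typ>\<open>bit\<close>,
  embedded by \<^term>\<open>of_bit\<close>.
\<close>

definition F2_scale :: "bit \<Rightarrow> 'a::field \<Rightarrow> 'a"
  where "F2_scale b x = of_bit b * x"

text \<open>
  The trace \<open>x + x\<^sup>2 + \<dots> + x\<^bsup>2^(m-1)\<^esup>\<close>, read as an element of \<^typ>\<open>bit\<close>. That the sum lies in
  the prime field, so that the case distinction loses nothing, is lemma
  \<open>of_bit_abs_trace\<close> below.
\<close>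

definition abs_trace :: "nat \<Rightarrow> 'a::field \<Rightarrow> bit"
  where "abs_trace m x = (if (\<Sum>i<m. x ^ (2 ^ i)) = 0 then 0 else 1)"

definition inv_perm :: "'a::field \<Rightarrow> 'a \<Rightarrow> 'a"
  where "inv_perm \<alpha> y = (if y = 0 then 0 else \<alpha> * inverse y)"

text \<open>
  Elements of \<open>\<int>/2\<^sup>k\<close> are represented by their residues in \<open>{0..<2 ^ k}\<close>; the product
  \<open>c * F x y\<close> need not be reduced, since it only occurs as an exponent of a
  \<open>2\<^sup>k\<close>-th root of unity.
\<close>

definition Z2k_bent :: "nat \<Rightarrow> nat \<Rightarrow> ('a::finite_field \<Rightarrow> 'a \<Rightarrow> int) \<Rightarrow> bool"
  where "Z2k_bent m k F \<longleftrightarrow>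
    (\<forall>x y. F x y \<in> {0..<2 ^ k}) \<and>
    (\<forall>c \<in> {0..<2 ^ k}. c \<noteq> 0 \<longrightarrow> (\<forall>u1 u2.
      cmod (\<Sum>x\<in>UNIV. \<Sum>y\<in>UNIV.
        exp (2 * of_real pi * \<i> / 2 ^ k) powi (c * F x y) *
        (- 1) powi (of_bit (abs_trace m (u1 * x + u2 * y)))) = 2 ^ m))"

lemma CHAR_eq_2:
  assumes "CARD('a::finite_field) = 2 ^ m"
  shows "CHAR('a) = 2"
proof -
  have "(of_nat CARD('a) :: 'a) = 0"
  proof -
    have "(\<Sum>x\<in>(UNIV :: 'a set). x + 1) = (\<Sum>x\<in>UNIV. x)"
      by (rule sum.reindex_bij_witness[of _ "\<lambda>x. x - 1" "\<lambda>x. x + 1"]) auto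
    thus ?thesis by (simp add: sum.distrib)
  qed
  hence "(2 :: 'a) = 0"
    using assms by simp
  hence "(of_nat 2 :: 'a) = 0" by simp
  hence "CHAR('a) dvd 2"
    by (simp only: of_nat_eq_0_iff_char_dvd)
  thus ?thesis
    using CHAR_prime[where ?'a = 'a] two_is_prime_nat primes_dvd_imp_eq by blast
qed

lemma of_bit_abs_trace:
  fixes x :: "'a::finite_field"
  assumes "CARD('a) = 2 ^ m"
  shows "of_bit (abs_trace m x) = (\<Sum>i<m. x ^ (2 ^ i))"
proof -
  define s where "s = (\<Sum>i<m. x ^ (2 ^ i))"
  have ch: "CHAR('a) = 2" using assms by (rule CHAR_eq_2)
  have "s ^ 2 = (\<Sum>i<m. (x ^ (2 ^ i)) ^ 2)"
    unfolding s_def using freshmans_dream_sum[where ?'a = 'a] ch two_is_prime_nat by metis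
  also have "\<dots> = (\<Sum>i<m. x ^ (2 ^ Suc i))"
    by (simp add: power_mult[symmetric] mult.commute)
  finally have s2: "s ^ 2 = (\<Sum>i<m. x ^ (2 ^ Suc i))" .
  have "s ^ 2 + x ^ (2 ^ 0) = s + x ^ (2 ^ m)"
  proof -
    have "(\<Sum>i<Suc m. x ^ (2 ^ i)) = x ^ (2 ^ 0) + (\<Sum>i<m. x ^ (2 ^ Suc i))"
      by (rule sum.lessThan_Suc_shift)
    moreover have "(\<Sum>i<Suc m. x ^ (2 ^ i)) = s + x ^ (2 ^ m)"
      by (simp add: s_def)
    ultimately show ?thesis using s2 by (simp add: add.commute)
  qed
  moreover have "x ^ (2 ^ m) = x"
    using finite_field_power_card_eq_same[of x] assms by simp
  ultimately have "s ^ 2 = s" by simp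
  hence "s = 0 \<or> s = 1"
    by (simp add: power2_eq_square)
  thus ?thesis
    unfolding abs_trace_def s_def[symmetric] by auto
qed

lemma vector_space_F2_scale:
  assumes "CARD('a::finite_field) = 2 ^ m"
  shows "vector_space (F2_scale :: bit \<Rightarrow> 'a \<Rightarrow> 'a)"
proof -
  have "of_nat CHAR('a) = (0 :: 'a)" by (rule of_nat_CHAR)
  hence two: "(1 :: 'a) + 1 = 0"
    using CHAR_eq_2[OF assms] by simp
  have xx: "x + x = 0" for x :: 'a
    using two by (metis distrib_left mult.right_neutral mult_zero_right)
  show ?thesis
  proof
    fix a b :: bit and x y :: 'a
    show "F2_scale (a + b) x = F2_scale a x + F2_scale b x"
      by (cases a; cases b) (simp_all add: F2_scale_def xx)
  qed (auto simp: F2_scale_def algebra_simps)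
qed

end

theory Submission
  imports Defs "HOL-Computational_Algebra.Polynomial"
begin

text \<open>
  Substituting \<open>x = z y\<close> for \<open>y \<noteq> 0\<close> turns \<open>F (x, y)\<close> into \<open>G z = \<Sum>i. 2\<^sup>i Tr (\<alpha>\<^sub>i z)\<close>, which no
  longer depends on \<open>y\<close>. Writing \<open>q = 2\<^sup>m\<close>, summing over \<open>y\<close> first leaves
  \<open>q [u\<^sub>1 = 0] + \<Sum>z. \<zeta>\<^bsup>c G z\<^esup> (q [u\<^sub>1 z + u\<^sub>2 = 0] - 1)\<close>. Each factor \<open>\<zeta>\<^bsup>c 2^i Tr (\<alpha>\<^sub>i z)\<^esup>\<close> is a
  combination of \<open>1\<close> and the character \<open>z \<mapsto> (-1)\<^bsup>Tr (\<alpha>\<^sub>i z)\<^esup>\<close>; expanding the product and using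
  that no nonempty subset of the \<open>\<alpha>\<^sub>i\<close> sums to zero gives
  \<open>\<Sum>z. \<zeta>\<^bsup>c G z\<^esup> = q \<Prod>i. (1 + \<zeta>\<^bsup>c 2^i\<^esup>) / 2\<close>. This vanishes because \<open>\<zeta>\<^bsup>c 2^i\<^esup> = -1\<close> for some
  \<open>i\<close>, and what remains has absolute value \<open>q\<close>.
\<close>

text \<open>The canonical additive character of the field, spelled with \<open>powi\<close> as in
  \<open>Z2k_bent\<close> so that unfolding alone links the two.\<close>

definition trace_char :: "nat \<Rightarrow> 'a::field \<Rightarrow> complex"
  where "trace_char m x = (- 1) powi (of_bit (abs_trace m x))"

lemma abs_trace_0 [simp]: "abs_trace m 0 = 0"
  by (simp add: abs_trace_def power_0_left)

lemma trace_char_0 [simp]: "trace_char m 0 = 1"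
  by (simp add: trace_char_def)

lemma trace_char_alt: "trace_char m x = (if abs_trace m x = 0 then 1 else - 1)"
  by (cases "abs_trace m x") (auto simp: trace_char_def)

text \<open>Powers of Frobenius are additive in characteristic 2; the equation is checked in the
  field, after applying \<open>of_bit\<close>.\<close>

lemma abs_trace_add:
  fixes x y :: "'a::finite_field"
  assumes "CARD('a) = 2 ^ m"
  shows "abs_trace m (x + y) = abs_trace m x + abs_trace m y"
proof -
  have ch: "CHAR('a) = 2" using assms by (rule CHAR_eq_2)
  have two: "(2 :: 'a) = 0"
    using of_nat_CHAR[where ?'a = 'a] ch by simp
  have "(x + y) ^ (2 ^ i) = x ^ (2 ^ i) + y ^ (2 ^ i)" for i
    using freshmans_dream'[of "2 ^ i" i x y] ch two_is_prime_nat by simp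
  hence "(of_bit (abs_trace m (x + y)) :: 'a) = of_bit (abs_trace m x) + of_bit (abs_trace m y)"
    by (simp only: of_bit_abs_trace[OF assms] sum.distrib)
  thus ?thesis
    by (cases "abs_trace m (x + y)"; cases "abs_trace m x"; cases "abs_trace m y")
       (simp_all add: two)
qed

lemma trace_char_add:
  fixes x y :: "'a::finite_field"
  assumes "CARD('a) = 2 ^ m"
  shows "trace_char m (x + y) = trace_char m x * trace_char m y"
  by (cases "abs_trace m x"; cases "abs_trace m y")
     (simp_all add: trace_char_alt abs_trace_add[OF assms])

lemma trace_char_sum:
  fixes g :: "'b \<Rightarrow> 'a::finite_field"
  assumes "CARD('a) = 2 ^ m"
  shows "trace_char m (sum g A) = (\<Prod>i\<in>A. trace_char m (g i))"
  by (induction A rule: infinite_finite_induct) (simp_all add: trace_char_add[OF assms])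

text \<open>As a polynomial the trace has degree at most \<open>2 ^ (m - 1)\<close>, too small for
  every field element to be a root.\<close>

lemma exists_abs_trace_nonzero:
  assumes "CARD('a::finite_field) = 2 ^ m"
  shows "\<exists>x :: 'a. abs_trace m x \<noteq> 0"
proof (rule ccontr)
  assume "\<nexists>x :: 'a. abs_trace m x \<noteq> 0"
  hence zero: "(\<Sum>i<m. x ^ (2 ^ i)) = 0" for x :: 'a
    by (metis abs_trace_def zero_neq_one)
  have "m \<noteq> 0"
  proof
    assume "m = 0"
    hence "CARD('a) = 1" using assms by simp
    thus False by (metis card_1_singletonE UNIV_I singletonD zero_neq_one)
  qed
  then obtain n where m: "m = Suc n" using not0_implies_Suc by blast
  define p :: "'a poly" where "p = (\<Sum>i<m. monom 1 (2 ^ i))"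
  have p_eval: "poly p x = 0" for x
    using zero[of x] by (simp add: p_def poly_sum poly_monom)
  \<comment> \<open>The exponents \<open>2 ^ i\<close> are distinct, so only the top monomial
    contributes.\<close>
  have "coeff p (2 ^ n) = (\<Sum>i<m. if i = n then 1 else 0)"
    by (simp add: p_def coeff_sum)
  hence "p \<noteq> 0" by (auto simp: m)
  have "degree p \<le> 2 ^ n"
    unfolding p_def
  proof (rule degree_sum_le)
    fix i assume "i \<in> {..<m}"
    thus "degree (monom (1::'a) (2 ^ i)) \<le> 2 ^ n"
      by (simp add: m degree_monom_eq)
  qed auto
  moreover have "CARD('a) \<le> degree p"
    using card_poly_roots_bound[OF \<open>p \<noteq> 0\<close>] p_eval by simp
  moreover have "(2::nat) ^ n < 2 ^ m" by (simp add: m)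
  ultimately show False using assms by linarith
qed

text \<open>Orthogonality: for nonzero \<open>a\<close>, shifting \<open>z\<close> by
  \<open>t / a\<close> with \<open>t\<close> of trace 1 negates the sum.\<close>

lemma sum_trace_char:
  fixes a :: "'a::finite_field"
  assumes "CARD('a) = 2 ^ m"
  shows "(\<Sum>z\<in>UNIV. trace_char m (a * z)) = (if a = 0 then 2 ^ m else 0)"
proof (cases "a = 0")
  case True
  thus ?thesis using assms by simp
next
  case False
  obtain t :: 'a where "abs_trace m t \<noteq> 0"
    using exists_abs_trace_nonzero[OF assms] by blast
  hence t: "trace_char m (a * (t / a)) = - 1"
    using False by (simp add: trace_char_alt)
  have "(\<Sum>z\<in>UNIV. trace_char m (a * z)) = (\<Sum>z\<in>UNIV. trace_char m (a * (z + t / a)))"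
    by (rule sum.reindex_bij_witness[of _ "\<lambda>z. z + t / a" "\<lambda>z. z - t / a"]) auto
  also have "\<dots> = - (\<Sum>z\<in>UNIV. trace_char m (a * z))"
    by (simp only: distrib_left trace_char_add[OF assms] t) (simp add: sum_negf)
  finally show ?thesis using False by simp
qed

text \<open>A vanishing subset sum is a linear relation with all coefficients 1. Injectivity turns
  the sum over indices into the sum over vectors that \<open>dependent\<close> refers to.\<close>

lemma independent_sum_nonzero:
  fixes \<alpha> :: "nat \<Rightarrow> 'a::finite_field"
  assumes "CARD('a) = 2 ^ m" and "inj_on \<alpha> I" and "\<not> module.dependent F2_scale (\<alpha> ` I)"
    and "finite T" "T \<subseteq> I" "T \<noteq> {}"
  shows "(\<Sum>i\<in>T. \<alpha> i) \<noteq> 0"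
proof
  interpret vector_space "F2_scale :: bit \<Rightarrow> 'a \<Rightarrow> 'a"
    using assms(1) by (rule vector_space_F2_scale)
  assume "(\<Sum>i\<in>T. \<alpha> i) = 0"
  moreover have "inj_on \<alpha> T" using assms inj_on_subset by blast
  ultimately have "(\<Sum>v\<in>\<alpha> ` T. F2_scale 1 v) = 0"
    by (simp add: sum.reindex)
  hence "dependent (\<alpha> ` I)"
    unfolding dependent_explicit using assms(4-6)
    by (intro exI[of _ "\<alpha> ` T"] exI[of _ "\<lambda>_. 1"]) auto
  thus False using assms(3) by simp
qed

lemma sum_of_bit_less:
  "(\<Sum>i<k. 2 ^ i * of_bit (b i)) \<in> {0..<2 ^ k :: int}"
proof (induction k)
  case (Suc k)
  thus ?case by (cases "b k") auto
qed simp

text \<open>For uniform \<open>z\<close> the bits \<open>abs_trace m (\<alpha> i * z)\<close> are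
  independent and unbiased, so the mean of the product is the product of the means.\<close>

lemma sum_prod_of_bit_trace:
  fixes \<alpha> :: "nat \<Rightarrow> 'a::finite_field" and w :: "nat \<Rightarrow> complex"
  assumes "CARD('a) = 2 ^ m" and "inj_on \<alpha> {..<k}"
    and "\<not> module.dependent F2_scale (\<alpha> ` {..<k})"
  shows "(\<Sum>z\<in>UNIV. \<Prod>i<k. if abs_trace m (\<alpha> i * z) = 0 then 1 else w i)
    = 2 ^ m * (\<Prod>i<k. (1 + w i) / 2)"
proof -
  let ?A = "\<lambda>i. (1 + w i) / 2" and ?B = "\<lambda>i. (1 - w i) / 2"
  have "(\<Sum>z\<in>UNIV. \<Prod>i<k. if abs_trace m (\<alpha> i * z) = 0 then 1 else w i)
    = (\<Sum>z\<in>UNIV. \<Prod>i<k. ?B i * trace_char m (\<alpha> i * z) + ?A i)"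
    \<comment> \<open>Linear interpolation in the character value: 1 gives 1 and -1 gives
      \<open>w i\<close>.\<close>
    by (intro sum.cong prod.cong) (auto simp: trace_char_alt field_simps)
  also have "\<dots> = (\<Sum>z\<in>UNIV. \<Sum>T\<in>Pow {..<k}.
      (\<Prod>i\<in>T. ?B i) * (\<Prod>i\<in>{..<k} - T. ?A i) * trace_char m ((\<Sum>i\<in>T. \<alpha> i) * z))"
    by (simp only: prod_add[OF finite_lessThan] prod.distrib sum_distrib_left
        trace_char_sum[OF assms(1)] mult_ac)
  also have "\<dots> = (\<Sum>T\<in>Pow {..<k}. (\<Prod>i\<in>T. ?B i) * (\<Prod>i\<in>{..<k} - T. ?A i) *
      (\<Sum>z\<in>UNIV. trace_char m ((\<Sum>i\<in>T. \<alpha> i) * z)))"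
    by (subst sum.swap) (simp add: sum_distrib_left)
  also have "\<dots> = (\<Sum>T\<in>Pow {..<k}. if T = {} then 2 ^ m * (\<Prod>i<k. ?A i) else 0)"
  proof (rule sum.cong[OF refl])
    fix T assume T: "T \<in> Pow {..<k}"
    hence "finite T" using finite_subset by auto
    thus "(\<Prod>i\<in>T. ?B i) * (\<Prod>i\<in>{..<k} - T. ?A i) *
        (\<Sum>z\<in>UNIV. trace_char m ((\<Sum>i\<in>T. \<alpha> i) * z))
      = (if T = {} then 2 ^ m * (\<Prod>i<k. ?A i) else 0)"
      using independent_sum_nonzero[OF assms, of T] T
      by (auto simp: sum_trace_char[OF assms(1)])
  qed
  also have "\<dots> = 2 ^ m * (\<Prod>i<k. ?A i)"
    by (subst sum.delta) auto
  finally show ?thesis .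
qed

lemma exists_root_powi_eq_minus_one:
  fixes c :: int
  assumes "c \<noteq> 0" "\<bar>c\<bar> < 2 ^ k"
  shows "\<exists>i<k. exp (2 * of_real pi * \<i> / 2 ^ k) powi (c * 2 ^ i) = - 1"
proof -
  obtain d where c: "c = 2 ^ multiplicity 2 c * d" and "\<not> 2 dvd d"
    using multiplicity_decompose'[of c 2] assms by auto
  define j where "j = multiplicity 2 c"
  have "d \<noteq> 0" using assms c by auto
  have "(2 :: int) ^ j \<le> 2 ^ j * \<bar>d\<bar>" using \<open>d \<noteq> 0\<close> by simp
  also have "\<dots> = \<bar>c\<bar>" using c by (metis abs_mult abs_numeral j_def power_abs)
  also have "\<dots> < 2 ^ k" by fact
  finally have "j < k" by simp
  \<comment> \<open>With \<open>c = 2 ^ j * d\<close> and \<open>d\<close> odd, this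
    \<open>i\<close> raises the power of 2 in \<open>c * 2 ^ i\<close> to exactly
    \<open>2 ^ (k - 1)\<close>, the exponent at which the root of unity becomes -1.\<close>
  define i where "i = k - 1 - j"
  let ?\<zeta> = "exp (2 * of_real pi * \<i> / 2 ^ k) :: complex"
  have k: "k = Suc (j + i)" using \<open>j < k\<close> by (simp add: i_def)
  have "?\<zeta> ^ (2 ^ (j + i)) = exp (of_real pi * \<i>)"
    unfolding exp_of_nat_mult[symmetric] k by (simp add: field_simps)
  hence half: "?\<zeta> ^ (2 ^ (j + i)) = - 1" by simp
  have "c * 2 ^ i = int (2 ^ (j + i)) * d"
    by (subst c) (simp add: j_def power_add)
  hence "?\<zeta> powi (c * 2 ^ i) = (?\<zeta> ^ (2 ^ (j + i))) powi d"
    by (simp only: power_int_mult power_int_of_nat)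
  also have "\<dots> = - 1" unfolding half using \<open>\<not> 2 dvd d\<close> by simp
  finally show ?thesis using k by (intro exI[of _ i]) auto
qed

lemma powi_sum:
  fixes a :: "'a::field"
  assumes "a \<noteq> 0"
  shows "a powi (sum g A) = (\<Prod>i\<in>A. a powi (g i))"
  by (induction A rule: infinite_finite_induct) (simp_all add: power_int_add assms)

theorem theorem4p10:
  fixes m k :: nat and \<alpha> :: "nat \<Rightarrow> 'a::finite_field"
    and f :: "nat \<Rightarrow> 'a \<Rightarrow> 'a \<Rightarrow> bit" and F :: "'a \<Rightarrow> 'a \<Rightarrow> int"
  assumes "CARD('a) = 2 ^ m"
    and "inj_on \<alpha> {..<k}"
    and "\<not> module.dependent F2_scale (\<alpha> ` {..<k})"
    and "\<And>i x y. i < k \<Longrightarrow> f i x y = abs_trace m (x * inv_perm (\<alpha> i) y)"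
    and "\<And>x y. F x y = (\<Sum>i<k. 2 ^ i * of_bit (f i x y))"
  shows "Z2k_bent m k F"
  unfolding Z2k_bent_def
proof (intro conjI allI ballI impI)
  fix x y
  show "F x y \<in> {0..<2 ^ k}"
    unfolding assms(5) by (rule sum_of_bit_less)
next
  fix c :: int and u1 u2 :: 'a
  assume c: "c \<in> {0..<2 ^ k}" "c \<noteq> 0"
  define \<zeta> :: complex where "\<zeta> = exp (2 * of_real pi * \<i> / 2 ^ k)"
  define G where "G z = (\<Sum>i<k. 2 ^ i * of_bit (abs_trace m (\<alpha> i * z)) :: int)" for z
  define h where "h z = \<zeta> powi (c * G z)" for z
  have "\<zeta> \<noteq> 0" by (simp add: \<zeta>_def)
  have "cmod \<zeta> = 1"
  proof -
    have "\<zeta> = exp (\<i> * of_real (2 * pi / 2 ^ k))" by (simp add: \<zeta>_def mult_ac)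
    thus ?thesis by (simp only: cis_conv_exp[symmetric] norm_cis)
  qed
  hence h_norm: "cmod (h z) = 1" for z by (simp add: h_def norm_power_int)
  have "h z = (\<Prod>i<k. if abs_trace m (\<alpha> i * z) = 0 then 1 else \<zeta> powi (c * 2 ^ i))" for z
  proof -
    have "h z = (\<Prod>i<k. \<zeta> powi (c * (2 ^ i * of_bit (abs_trace m (\<alpha> i * z)))))"
      unfolding h_def G_def sum_distrib_left by (rule powi_sum[OF \<open>\<zeta> \<noteq> 0\<close>])
    also have "\<dots> = (\<Prod>i<k. if abs_trace m (\<alpha> i * z) = 0 then 1 else \<zeta> powi (c * 2 ^ i))"
      by (intro prod.cong) auto
    finally show ?thesis .
  qed
  hence "(\<Sum>z\<in>UNIV. h z) = 2 ^ m * (\<Prod>i<k. (1 + \<zeta> powi (c * 2 ^ i)) / 2)"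
    using sum_prod_of_bit_trace[OF assms(1-3)] by simp
  also have "(\<Prod>i<k. (1 + \<zeta> powi (c * 2 ^ i)) / 2) = 0"
  proof -
    obtain i where "i < k" "\<zeta> powi (c * 2 ^ i) = - 1"
      using exists_root_powi_eq_minus_one[of c k] c unfolding \<zeta>_def by auto
    thus ?thesis by (intro prod_zero bexI[of _ i]) auto
  qed
  finally have h_sum: "(\<Sum>z\<in>UNIV. h z) = 0" by simp
  have F0: "F x 0 = 0" for x
    by (simp add: assms(4,5) inv_perm_def)
  have FG: "F (z * y) y = G z" if "y \<noteq> 0" for y z
  proof -
    have *: "z * y * inv_perm a y = a * z" for a
      using that by (simp add: inv_perm_def)
    show ?thesis
      unfolding assms(5) G_def by (intro sum.cong) (simp_all only: assms(4) * lessThan_iff)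
  qed
  \<comment> \<open>For fixed nonzero \<open>y\<close>, the map from \<open>z\<close> to
    \<open>z * y\<close> permutes the field.\<close>
  have inner: "(\<Sum>x\<in>UNIV. \<zeta> powi (c * F x y) * trace_char m (u1 * x + u2 * y))
    = (\<Sum>z\<in>UNIV. h z * trace_char m ((u1 * z + u2) * y))" if "y \<noteq> 0" for y
    using that
    by (intro sum.reindex_bij_witness[of _ "\<lambda>z. z * y" "\<lambda>x. x / y"])
       (auto simp: h_def FG[symmetric] algebra_simps)
  have "(\<Sum>x\<in>UNIV. \<Sum>y\<in>UNIV. \<zeta> powi (c * F x y) * trace_char m (u1 * x + u2 * y))
    = (\<Sum>y\<in>UNIV. \<Sum>x\<in>UNIV. \<zeta> powi (c * F x y) * trace_char m (u1 * x + u2 * y))"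
    by (rule sum.swap)
  also have "\<dots> = (\<Sum>x\<in>UNIV. trace_char m (u1 * x))
      + (\<Sum>y\<in>UNIV - {0}. \<Sum>z\<in>UNIV. h z * trace_char m ((u1 * z + u2) * y))"
    by (subst sum.remove[of _ 0]) (simp_all add: F0 inner)
  \<comment> \<open>Restoring \<open>y = 0\<close> adds the sum of all \<open>h z\<close>, which is
    0, and makes the sums over \<open>y\<close> complete character sums.\<close>
  also have "(\<Sum>y\<in>UNIV - {0}. \<Sum>z\<in>UNIV. h z * trace_char m ((u1 * z + u2) * y))
    = (\<Sum>y\<in>UNIV. \<Sum>z\<in>UNIV. h z * trace_char m ((u1 * z + u2) * y))"
    using h_sum by (subst (2) sum.remove[of _ 0]) simp_all
  also have "\<dots> = (\<Sum>z\<in>UNIV. h z * (\<Sum>y\<in>UNIV. trace_char m ((u1 * z + u2) * y)))"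
    by (subst sum.swap) (simp add: sum_distrib_left)
  also have "\<dots> = (\<Sum>z\<in>UNIV. if u1 * z + u2 = 0 then 2 ^ m * h z else 0)"
    by (intro sum.cong) (simp_all add: sum_trace_char[OF assms(1)])
  finally have W: "(\<Sum>x\<in>UNIV. \<Sum>y\<in>UNIV. \<zeta> powi (c * F x y) * trace_char m (u1 * x + u2 * y))
    = (if u1 = 0 then 2 ^ m else 0) + (\<Sum>z\<in>UNIV. if u1 * z + u2 = 0 then 2 ^ m * h z else 0)"
    by (simp only: sum_trace_char[OF assms(1)])
  have "cmod (\<Sum>x\<in>UNIV. \<Sum>y\<in>UNIV. \<zeta> powi (c * F x y) * trace_char m (u1 * x + u2 * y)) = 2 ^ m"
  proof (cases "u1 = 0")
    case True
    \<comment> \<open>The condition is now independent of \<open>z\<close>, so the sum is empty or a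
      multiple of the vanishing sum of \<open>h\<close>; the modulus comes from the row
      \<open>y = 0\<close>.\<close>
    have "(\<Sum>z\<in>UNIV. if u1 * z + u2 = 0 then 2 ^ m * h z else 0) = 0"
      using True h_sum by (cases "u2 = 0") (simp_all add: sum_distrib_left[symmetric])
    thus ?thesis using W True by (simp add: norm_power)
  next
    case False
    \<comment> \<open>Exactly one \<open>z\<close> survives, and it contributes \<open>2 ^ m\<close>
      times a number of modulus 1.\<close>
    hence "u1 * z + u2 = 0 \<longleftrightarrow> z = - u2 / u1" for z
      by (auto simp: field_simps eq_neg_iff_add_eq_0)
    thus ?thesis using W False by (simp add: norm_mult norm_power h_norm)
  qed
  thus "cmod (\<Sum>x\<in>UNIV. \<Sum>y\<in>UNIV. exp (2 * of_real pi * \<i> / 2 ^ k) powi (c * F x y) *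
      (- 1) powi (of_bit (abs_trace m (u1 * x + u2 * y)))) = 2 ^ m"
    by (simp only: \<zeta>_def trace_char_def)
qed

end
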